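(* The Markoff spectrum $\mathscr M(\mathbf H_4)$ of the Hecke group $\mathbf H_4$ is closed (as a subset of $\mathbb R$), and the Lagrange spectrum $\mathscr L(\mathbf H_4)$ is contained in it: $\mathscr L(\mathbf H_4)\subset \mathscr M(\mathbf H_4)$.
   Context: $\mathbf H_4$ is the subgroup of $\mathrm{PSL}_2(\mathbb R)$ generated by $S=\begin{pmatrix}0&-1\\1&0\end{pmatrix}$ and $T=\begin{pmatrix}1&\sqrt2\\0&1\end{pmatrix}$. It acts on $\hat{\mathbb R}=\mathbb R\cup\{\infty\}$ by linear fractional transformations $\begin{pmatrix}a&b\\c&d\end{pmatrix}\cdot z=\frac{az+b}{cz+d}$. The orbit of $\infty$ is $\mathbb Q(\mathbf H_4)=\sqrt2\,\mathbb Q\cup\{\infty\}$. Markoff spectrum: $\mathscr M(\mathbf H_4)$ is the set of all finite values of $\sup_{M\in\mathbf H_4}|M^{-1}\cdot\xi-M^{-1}\cdot\eta|$ over all $\xi\neq\eta$ in $\hat{\mathbb R}$ (where $|x-y|=\infty$ if exactly one of $x,y$ is $\infty$). Lagrange spectrum: for $\xi\in\mathbb R\setminus\sqrt2\,\mathbb Q$, let $L_{\mathbf H_4}(\xi)$ be the supremum of all $L>0$ such that $\left|\xi-\frac ac\right|<\frac1{Lc^2}$ holds for infinitely many points $M\cdot\infty=\frac ac$ with $M=\begin{pmatrix}a&b\\c&d\end{pmatrix}\in\mathbf H_4$, $c\ne0$. Then $\mathscr L(\mathbf H_4)$ is the set of all finite values $L_{\mathbf H_4}(\xi)$, $\xi\in\mathbb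 R\setminus\sqrt2\,\mathbb Q$. *)

theory Defs
  imports "HOL-Analysis.Analysis" "HOL-Algebra.Generated_Groups"
begin

definition SL2 :: "(real^2^2) monoid" where
  "SL2 = \<lparr>carrier = {A. det A = 1}, mult = (**), one = mat 1\<rparr>"

definition PSL2 :: "(real^2^2) set monoid" where
  "PSL2 = SL2 Mod {mat 1, - mat 1}"

definition psl :: "real^2^2 \<Rightarrow> (real^2^2) set" where
  "psl A = {mat 1, - mat 1} #>\<^bsub>SL2\<^esub> A"

definition matS :: "real^2^2" where
  "matS = vector [vector [0, -1], vector [1, 0]]"

definition matT :: "real^2^2" where
  "matT = vector [vector [1, sqrt 2], vector [0, 1]]"

definition H4 :: "(real^2^2) set set" where
  "H4 = generate PSL2 {psl matS, psl matT}"

text \<open>The projective line \<open>\<real> \<union> {\<infinity>}\<close>, with a single point at infinity (unlike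
  \<^typ>\<open>ereal\<close>).\<close>

datatype rhat = Fin real | Infty

fun moebius :: "real^2^2 \<Rightarrow> rhat \<Rightarrow> rhat" where
  "moebius A (Fin z) =
     (if A$2$1 * z + A$2$2 = 0 then Infty
      else Fin ((A$1$1 * z + A$1$2) / (A$2$1 * z + A$2$2)))"
| "moebius A Infty = (if A$2$1 = 0 then Infty else Fin (A$1$1 / A$2$1))"

text \<open>The value of \<open>rdist\<close> at \<open>(\<infinity>, \<infinity>)\<close> is arbitrary: below, \<open>rdist\<close> is only applied to
  two distinct points.\<close>

fun rdist :: "rhat \<Rightarrow> rhat \<Rightarrow> ereal" where
  "rdist (Fin x) (Fin y) = ereal \<bar>x - y\<bar>"
| "rdist (Fin x) Infty = \<infinity>"
| "rdist Infty (Fin y) = \<infinity>"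
| "rdist Infty Infty = 0"

text \<open>An element of \<^const>\<open>PSL2\<close> is a set \<open>{A, -A}\<close>, so \<open>\<Union>H4\<close> is the set of all matrices that
  represent an element of \<^const>\<open>H4\<close>.  Everything evaluated at such a matrix below (its
  action on \<^typ>\<open>rhat\<close>, the action of its inverse, and the square of its lower left entry)
  is unchanged under \<open>A \<mapsto> -A\<close>.\<close>

definition markoff_value :: "rhat \<Rightarrow> rhat \<Rightarrow> ereal" where
  "markoff_value \<xi> \<eta> =
     (SUP A\<in>\<Union>H4. rdist (moebius (matrix_inv A) \<xi>) (moebius (matrix_inv A) \<eta>))"

definition markoff_spectrum :: "real set" where
  "markoff_spectrum = {m. \<exists>\<xi> \<eta>. \<xi> \<noteq> \<eta> \<and> markoff_value \<xi> \<eta> = ereal m}"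

text \<open>The set in \<open>approximants\<close> consists of points \<open>x = A\<cdot>\<infinity>\<close>, so each point counts once,
  however many matrices produce it.\<close>

definition approximants :: "real \<Rightarrow> real \<Rightarrow> real set" where
  "approximants \<xi> L =
     {x. \<exists>A\<in>\<Union>H4. A$2$1 \<noteq> 0 \<and> moebius A Infty = Fin x \<and> \<bar>\<xi> - x\<bar> < 1 / (L * (A$2$1)\<^sup>2)}"

definition lagrange_value :: "real \<Rightarrow> ereal" where
  "lagrange_value \<xi> = (SUP L\<in>{L. L > 0 \<and> infinite (approximants \<xi> L)}. ereal L)"

definition lagrange_spectrum :: "real set" where
  "lagrange_spectrum =
     {l. \<exists>\<xi>. \<xi> \<notin> (\<lambda>q. sqrt 2 * q) ` \<rat> \<and> lagrange_value \<xi> = ereal l}"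

lemma psl_eq: "psl A = {A, - A}"
  by (auto simp: psl_def r_coset_def SL2_def vec_eq_iff matrix_matrix_mult_def sum_2 mat_def forall_2)

lemma moebius_uminus: "moebius (- A) z = moebius A z"
proof (cases z)
  case (Fin x)
  have "- (A$2$1 * x) - A$2$2 = - (A$2$1 * x + A$2$2)" "- (A$1$1 * x) - A$1$2 = - (A$1$1 * x + A$1$2)"
    by auto
  then show ?thesis
    unfolding Fin moebius.simps
    by (smt (verit, ccfv_threshold) minus_divide_divide mult_minus_left vector_uminus_component)
qed simp

lemma matrix_inv_SL2:
  fixes A :: "real^2^2"
  assumes "A \<in> carrier SL2"
  shows "A ** matrix_inv A = mat 1" "matrix_inv A ** A = mat 1" "matrix_inv A \<in> carrier SL2"
proof -
  have d: "det A = 1" using assms by (simp add: SL2_def)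
  then have i: "invertible A" by (simp add: invertible_det_nz)
  show 1: "A ** matrix_inv A = mat 1" "matrix_inv A ** A = mat 1"
    using someI_ex[OF i[unfolded invertible_def]] by (simp_all add: matrix_inv_def)
  have "det A * det (matrix_inv A) = 1"
    using 1(1) by (metis det_I det_mul)
  then show "matrix_inv A \<in> carrier SL2" using d by (simp add: SL2_def)
qed

lemma group_SL2: "group SL2"
proof (rule groupI)
  fix A assume "A \<in> carrier SL2"
  then show "\<exists>B\<in>carrier SL2. B \<otimes>\<^bsub>SL2\<^esub> A = \<one>\<^bsub>SL2\<^esub>"
    using matrix_inv_SL2[of A] by (auto simp: SL2_def)
qed (auto simp: SL2_def det_mul det_I matrix_mul_assoc)

lemma normal_center_SL2: "{mat 1, - mat 1} \<lhd> SL2"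
proof -
  interpret group SL2 by (rule group_SL2)
  have m: "A ** (- mat 1) = - A" "- mat 1 ** A = - A" for A :: "real^2^2"
    by (auto simp: vec_eq_iff matrix_matrix_mult_def sum_2 mat_def forall_2)
  have d: "det (- mat 1 :: real^2^2) = 1" by (simp add: det_2 mat_def)
  have sg: "subgroup {mat 1, - mat 1} SL2"
  proof (rule subgroupI)
    fix a assume a: "a \<in> {mat 1, - mat 1 :: real^2^2}"
    have "a \<otimes>\<^bsub>SL2\<^esub> a = \<one>\<^bsub>SL2\<^esub>" using a m by (auto simp: SL2_def)
    moreover have "a \<in> carrier SL2" using a d by (auto simp: SL2_def det_I)
    ultimately have "inv\<^bsub>SL2\<^esub> a = a" by (simp add: inv_equality)
    then show "inv\<^bsub>SL2\<^esub> a \<in> {mat 1, - mat 1}" using a by simp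
  qed (use m d in \<open>auto simp: SL2_def det_I\<close>)
  show ?thesis
    by (rule normalI[OF sg]) (auto simp: r_coset_def l_coset_def SL2_def m)
qed

lemma group_PSL2: "group PSL2"
  unfolding PSL2_def by (rule normal.factorgroup_is_group[OF normal_center_SL2])

lemma psl_carrier: "A \<in> carrier SL2 \<Longrightarrow> psl A \<in> carrier PSL2"
  by (auto simp: psl_def PSL2_def FactGroup_def RCOSETS_def)

lemma subgroup_H4: "subgroup H4 PSL2"
proof -
  have "matS \<in> carrier SL2" "matT \<in> carrier SL2"
    by (simp_all add: SL2_def matS_def matT_def det_2)
  then show ?thesis
    unfolding H4_def
    by (intro group.generate_is_subgroup[OF group_PSL2]) (auto intro: psl_carrier)
qed

end

theory Submission imports Defs
begin

text \<open>
  For a matrix \<open>A\<close> of determinant 1 with first column \<open>(a, c)\<close> the difference formula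
  \<open>\<bar>A\<inverse>\<cdot>x - A\<inverse>\<cdot>y\<bar> = \<bar>x - y\<bar> / (\<bar>a - c x\<bar> \<bar>a - c y\<bar>)\<close> turns a bound \<open>m\<close> on all distances in
  an orbit of pairs into the inequalities \<open>\<bar>x - y\<bar> \<le> m \<bar>a - c x\<bar> \<bar>a - c y\<bar>\<close>, one for each \<open>A\<close>. These
  are continuous in \<open>x\<close> and \<open>y\<close> and so survive limits. Suppose now that pairs \<open>(x\<^sub>n, y\<^sub>n)\<close> have
  \<open>y\<^sub>n\<close> bounded and \<open>\<bar>x\<^sub>n - y\<^sub>n\<bar>\<close> tending to some \<open>m > 0\<close>, and that for each fixed \<open>A\<close> and each
  \<open>K > m\<close> the inequality with \<open>K\<close> in place of \<open>m\<close> holds for all large \<open>n\<close>. A subsequence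
  converges to a pair at distance exactly \<open>m\<close>, all inequalities hold for it with the constant
  \<open>m\<close>, and so its Markoff value is \<open>m\<close>, attained at the identity. Both halves of the theorem apply
  this principle, \<open>markoff_spectrum_limit\<close>.

  Closedness: for Markoff values \<open>m\<^sub>n\<close> tending to \<open>m\<close>, take in the orbit of a pair with value \<open>m\<^sub>n\<close>
  a member whose distance is almost \<open>m\<^sub>n\<close>, translated so that \<open>y\<^sub>n\<close> is near 0
  (\<open>markoff_value_pair\<close>). The limit \<open>m\<close> is positive because every Markoff value is at least
  \<open>1 / 2\<close> (\<open>markoff_spectrum_ge\<close>): two close points near 0 are driven apart by \<open>S\<close>.

  Lagrange values: for \<open>M\<close> in the group with first column \<open>(a, c)\<close>,
  \<open>\<bar>M\<inverse>\<cdot>\<xi> - M\<inverse>\<cdot>\<infinity>\<bar> = 1 / (\<bar>c\<bar> \<bar>a - c \<xi>\<bar>)\<close> measures how well \<open>a / c\<close> approximates \<open>\<xi>\<close>. Take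
  \<open>M\<^sub>n\<close> in the group with \<open>\<bar>c\<^sub>n\<bar> \<rightarrow> \<infinity>\<close> whose approximations \<open>a\<^sub>n / c\<^sub>n\<close> have quality
  almost \<open>l\<close>, the Lagrange value of \<open>\<xi>\<close>, and consider the pairs \<open>(M\<^sub>n\<inverse>\<cdot>\<xi>, M\<^sub>n\<inverse>\<cdot>\<infinity>)\<close>. The inequality
  for \<open>A\<close> and \<open>K > l\<close> says that \<open>M\<^sub>n A \<cdot> \<infinity>\<close> does not approximate \<open>\<xi>\<close> with quality more than \<open>K\<close>.
  Only finitely many points do, and \<open>M\<^sub>n A \<cdot> \<infinity>\<close> avoids each of them for large \<open>n\<close>: the lower left
  entry of \<open>A = M\<^sub>n\<inverse> (M\<^sub>n A)\<close> is fixed, whereas \<open>c\<^sub>n\<close> times the distance of \<open>a\<^sub>n / c\<^sub>n\<close> from a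
  fixed cusp, which differs from \<open>\<xi>\<close>, tends to infinity. This last step uses that the nonzero
  entries of group elements have absolute value at least 1.
\<close>

section \<open>Matrices representing elements of the Hecke group\<close>

lemma matrix_inv_det_1:
  fixes A :: "real^2^2"
  assumes "det A = 1"
  shows "matrix_inv A = vector [vector [A$2$2, - A$1$2], vector [- A$2$1, A$1$1]]"
proof -
  let ?B = "vector [vector [A$2$2, - A$1$2], vector [- A$2$1, A$1$1]] :: real^2^2"
  have AB: "A ** ?B = mat 1"
    using assms by (simp add: vec_eq_iff matrix_matrix_mult_def sum_2 mat_def forall_2 det_2 algebra_simps)
  have "matrix_inv A ** A = mat 1"
    using assms matrix_inv_SL2(2) by (simp add: SL2_def)
  then have "?B = (matrix_inv A ** A) ** ?B" by simp
  also have "\<dots> = matrix_inv A ** (A ** ?B)" by (simp only: matrix_mul_assoc)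
  finally show ?thesis using AB by simp
qed

lemma psl_mult:
  assumes "A \<in> carrier SL2" "B \<in> carrier SL2"
  shows "psl A \<otimes>\<^bsub>PSL2\<^esub> psl B = psl (A ** B)"
proof -
  have "psl A \<otimes>\<^bsub>PSL2\<^esub> psl B = psl (A \<otimes>\<^bsub>SL2\<^esub> B)"
    using normal.rcos_sum[OF normal_center_SL2 assms]
    by (simp add: psl_def PSL2_def FactGroup_def)
  then show ?thesis by (simp add: SL2_def)
qed

lemma psl_inv:
  assumes "A \<in> carrier SL2"
  shows "inv\<^bsub>PSL2\<^esub> (psl A) = psl (matrix_inv A)"
proof -
  interpret group PSL2 by (rule group_PSL2)
  have "psl (matrix_inv A) \<otimes>\<^bsub>PSL2\<^esub> psl A = psl (mat 1)"
    using psl_mult matrix_inv_SL2[OF assms] assms by simp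
  also have "\<dots> = \<one>\<^bsub>PSL2\<^esub>"
    by (auto simp: psl_eq PSL2_def FactGroup_def)
  finally show ?thesis
    using assms matrix_inv_SL2(3) by (intro inv_equality psl_carrier) auto
qed

definition sqrt2_Ints :: "real set" where
  "sqrt2_Ints = range (\<lambda>k::int. sqrt 2 * of_int k)"

text \<open>Integers and integer multiples of \<open>\<surd>2\<close> occupy the two diagonals in one of two ways. Both
  generators are of one of these kinds, and products and inverses stay within the two kinds. The
  discreteness of the group enters through this shape.\<close>

definition hecke_shape :: "real^2^2 \<Rightarrow> bool" where
  "hecke_shape A \<longleftrightarrow> det A = 1 \<and>
     (A$1$1 \<in> \<int> \<and> A$2$2 \<in> \<int> \<and> A$1$2 \<in> sqrt2_Ints \<and> A$2$1 \<in> sqrt2_Ints \<or>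
      A$1$1 \<in> sqrt2_Ints \<and> A$2$2 \<in> sqrt2_Ints \<and> A$1$2 \<in> \<int> \<and> A$2$1 \<in> \<int>)"

lemma sqrt2_Ints_of_int [intro]: "sqrt 2 * of_int k \<in> sqrt2_Ints"
  by (simp add: sqrt2_Ints_def)

lemma sqrt2_Ints_cases:
  assumes "x \<in> sqrt2_Ints"
  obtains k :: int where "x = sqrt 2 * of_int k"
  using assms by (auto simp: sqrt2_Ints_def)

lemma sqrt2_Ints_add:
  assumes "x \<in> sqrt2_Ints" "y \<in> sqrt2_Ints"
  shows "x + y \<in> sqrt2_Ints"
proof -
  obtain k l :: int where "x = sqrt 2 * of_int k" "y = sqrt 2 * of_int l"
    using assms by (auto elim!: sqrt2_Ints_cases)
  then have "x + y = sqrt 2 * of_int (k + l)" by (simp add: distrib_left)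
  then show ?thesis using sqrt2_Ints_of_int by metis
qed

lemma sqrt2_Ints_minus:
  assumes "x \<in> sqrt2_Ints"
  shows "- x \<in> sqrt2_Ints"
proof -
  obtain k :: int where "x = sqrt 2 * of_int k" using assms by (rule sqrt2_Ints_cases)
  then have "- x = sqrt 2 * of_int (- k)" by simp
  then show ?thesis using sqrt2_Ints_of_int by metis
qed

lemma sqrt2_Ints_mult:
  assumes "x \<in> sqrt2_Ints" "y \<in> sqrt2_Ints"
  shows "x * y \<in> \<int>"
proof -
  obtain k l :: int where "x = sqrt 2 * of_int k" "y = sqrt 2 * of_int l"
    using assms by (auto elim!: sqrt2_Ints_cases)
  then have "x * y = of_int (2 * k * l)" by simp
  then show ?thesis using Ints_of_int by metis
qed

lemma sqrt2_Ints_mult_Ints: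
  assumes "x \<in> sqrt2_Ints" "y \<in> \<int>"
  shows "x * y \<in> sqrt2_Ints" "y * x \<in> sqrt2_Ints"
proof -
  obtain k l :: int where "x = sqrt 2 * of_int k" "y = of_int l"
    using assms by (auto elim!: sqrt2_Ints_cases Ints_cases)
  then have "x * y = sqrt 2 * of_int (k * l)" by simp
  then show "x * y \<in> sqrt2_Ints" using sqrt2_Ints_of_int by metis
  then show "y * x \<in> sqrt2_Ints" by (simp add: mult.commute)
qed

lemma hecke_shape_mult:
  assumes "hecke_shape A" "hecke_shape B"
  shows "hecke_shape (A ** B)"
proof -
  have entry: "(A ** B) $ i $ j = A$i$1 * B$1$j + A$i$2 * B$2$j" for i j
    by (simp add: matrix_matrix_mult_def sum_2)
  have "det (A ** B) = 1" using assms by (simp add: hecke_shape_def det_mul)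
  with assms show ?thesis
    unfolding hecke_shape_def entry
    by (elim conjE disjE; simp add: sqrt2_Ints_add sqrt2_Ints_mult sqrt2_Ints_mult_Ints)
qed

lemma hecke_shape_inv: "hecke_shape A \<Longrightarrow> hecke_shape (matrix_inv A)"
  unfolding hecke_shape_def
  by (auto simp: matrix_inv_det_1 det_2 mult.commute intro: sqrt2_Ints_minus)

lemma hecke_shape_uminus: "hecke_shape A \<Longrightarrow> hecke_shape (- A)"
  unfolding hecke_shape_def by (auto simp: det_2 intro: sqrt2_Ints_minus)

lemma hecke_shape_SL2: "hecke_shape A \<Longrightarrow> A \<in> carrier SL2"
  by (simp add: hecke_shape_def SL2_def)

lemma hecke_shape_generators: "hecke_shape matS" "hecke_shape matT" "hecke_shape (mat 1)"
proof -
  have "0 \<in> sqrt2_Ints" "sqrt 2 \<in> sqrt2_Ints"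
    unfolding sqrt2_Ints_def by (auto intro: range_eqI[of _ _ 0] range_eqI[of _ _ 1])
  then show "hecke_shape matS" "hecke_shape matT" "hecke_shape (mat 1)"
    by (auto simp: hecke_shape_def matS_def matT_def det_2 mat_def)
qed

lemma H4_elements:
  assumes "h \<in> H4"
  shows "\<exists>A. h = psl A \<and> hecke_shape A"
  using assms unfolding H4_def
proof (induction rule: generate.induct)
  case one
  have "\<one>\<^bsub>PSL2\<^esub> = psl (mat 1)" by (auto simp: psl_eq PSL2_def FactGroup_def)
  then show ?case using hecke_shape_generators by blast
next
  case (incl h)
  then show ?case using hecke_shape_generators by blast
next
  case (inv h)
  then show ?case
    using hecke_shape_generators hecke_shape_inv psl_inv hecke_shape_SL2 by blast
next
  case (eng h1 h2)
  then show ?case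
    using hecke_shape_mult psl_mult hecke_shape_SL2 by metis
qed

text \<open>An element of \<open>H4\<close> is the full set \<open>{A, -A}\<close>, so it may be recovered from any matrix in it.\<close>

lemma psl_in_H4_iff: "psl A \<in> H4 \<longleftrightarrow> A \<in> \<Union>H4"
proof
  assume "A \<in> \<Union>H4"
  then obtain B where "A \<in> psl B" "psl B \<in> H4" using H4_elements by blast
  moreover from this have "psl A = psl B" by (auto simp: psl_eq)
  ultimately show "psl A \<in> H4" by simp
qed (auto simp: psl_eq)

lemma Union_H4_shape: "A \<in> \<Union>H4 \<Longrightarrow> hecke_shape A"
  using H4_elements hecke_shape_uminus by (auto simp: psl_eq)

lemma Union_H4_det: "A \<in> \<Union>H4 \<Longrightarrow> det A = 1"
  using Union_H4_shape by (simp add: hecke_shape_def)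

lemma Union_H4_mult:
  assumes "A \<in> \<Union>H4" "B \<in> \<Union>H4"
  shows "A ** B \<in> \<Union>H4"
  using assms subgroup.m_closed[OF subgroup_H4] psl_mult Union_H4_shape hecke_shape_SL2
  unfolding psl_in_H4_iff[symmetric] by metis

lemma Union_H4_inv:
  assumes "A \<in> \<Union>H4"
  shows "matrix_inv A \<in> \<Union>H4"
  using assms subgroup.m_inv_closed[OF subgroup_H4] psl_inv Union_H4_shape hecke_shape_SL2
  unfolding psl_in_H4_iff[symmetric] by metis

lemma Union_H4_generators: "matS \<in> \<Union>H4" "matT \<in> \<Union>H4"
proof -
  have "psl matS \<in> H4" "psl matT \<in> H4"
    unfolding H4_def by (auto intro: generate.incl)
  then show "matS \<in> \<Union>H4" "matT \<in> \<Union>H4" by (simp_all only: psl_in_H4_iff)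
qed

lemma Union_H4_one: "mat 1 \<in> \<Union>H4"
  using Union_H4_mult[OF Union_H4_inv Union_H4_generators(1)] Union_H4_generators(1)
    matrix_inv_SL2(2) hecke_shape_SL2 hecke_shape_generators(1) by metis

definition translation :: "int \<Rightarrow> real^2^2" where
  "translation k = vector [vector [1, sqrt 2 * of_int k], vector [0, 1]]"

lemma translation_in_H4: "translation k \<in> \<Union>H4"
proof (induction k rule: int_induct[where k = 0])
  case base
  have "translation 0 = mat 1"
    by (simp add: translation_def vec_eq_iff mat_def forall_2)
  then show ?case using Union_H4_one by simp
next
  case (step1 k)
  have "translation (k + 1) = translation k ** matT"
    by (simp add: translation_def matT_def vec_eq_iff matrix_matrix_mult_def sum_2 forall_2 algebra_simps)
  then show ?case using step1 Union_H4_mult Union_H4_generators by simp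
next
  case (step2 k)
  have "translation (k - 1) = translation k ** matrix_inv matT"
    using Union_H4_det[OF Union_H4_generators(2)]
    by (simp add: matrix_inv_det_1 translation_def matT_def vec_eq_iff matrix_matrix_mult_def
        sum_2 forall_2 algebra_simps)
  then show ?case using step2 Union_H4_mult Union_H4_generators Union_H4_inv by simp
qed

lemma translate_near_0: "\<exists>k::int. \<bar>y - sqrt 2 * of_int k\<bar> \<le> sqrt 2 / 2"
proof
  have "\<bar>y / sqrt 2 - of_int (round (y / sqrt 2))\<bar> \<le> 1 / 2"
    by (metis abs_minus_commute of_int_round_abs_le)
  then have "sqrt 2 * \<bar>y / sqrt 2 - of_int (round (y / sqrt 2))\<bar> \<le> sqrt 2 * (1 / 2)"
    by (intro mult_left_mono) auto
  then show "\<bar>y - sqrt 2 * of_int (round (y / sqrt 2))\<bar> \<le> sqrt 2 / 2"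
    by (simp add: abs_mult[of "sqrt 2", simplified, symmetric] right_diff_distrib)
qed

lemma sqrt2_half_less_1: "sqrt 2 / 2 < 1"
  using sqrt2_less_2 by simp

section \<open>The action on the projective line\<close>

text \<open>The point of the projective line with homogeneous coordinates \<open>(x : y)\<close>. In these coordinates
  \<open>moebius\<close> is matrix-vector multiplication, which makes the composition law immediate.\<close>

fun homog :: "real \<Rightarrow> real \<Rightarrow> rhat" where
  "homog x y = (if y = 0 then Infty else Fin (x / y))"

lemma moebius_homog:
  assumes "x \<noteq> 0 \<or> y \<noteq> 0"
  shows "moebius A (homog x y) = homog (A$1$1 * x + A$1$2 * y) (A$2$1 * x + A$2$2 * y)"
proof (cases "y = 0")
  case False
  have "A$2$1 * (x / y) + A$2$2 = (A$2$1 * x + A$2$2 * y) / y"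
    "A$1$1 * (x / y) + A$1$2 = (A$1$1 * x + A$1$2 * y) / y"
    using False by (simp_all add: add_divide_distrib)
  then show ?thesis using False by simp
qed (use assms in simp)

lemma moebius_mult:
  assumes "det B \<noteq> 0"
  shows "moebius A (moebius B z) = moebius (A ** B) z"
proof -
  obtain x y where xy: "x \<noteq> 0 \<or> y \<noteq> 0" "z = homog x y"
  proof (cases z)
    case (Fin r)
    then show ?thesis using that[of r 1] by simp
  next
    case Infty
    then show ?thesis using that[of 1 0] by simp
  qed
  have "B$1$1 * x + B$1$2 * y \<noteq> 0 \<or> B$2$1 * x + B$2$2 * y \<noteq> 0"
  proof (rule ccontr)
    assume "\<not> ?thesis"
    then have "B$1$1 * x + B$1$2 * y = 0" "B$2$1 * x + B$2$2 * y = 0" by auto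
    then have "det B * x = 0" "det B * y = 0" unfolding det_2 by algebra+
    then show False using assms xy by simp
  qed
  then show ?thesis
    unfolding xy(2) moebius_homog[OF xy(1)] by (subst moebius_homog)
      (simp_all add: matrix_matrix_mult_def sum_2 algebra_simps del: homog.simps)
qed

lemma moebius_inj:
  assumes "det A = 1" "moebius A z = moebius A w"
  shows "z = w"
proof -
  have 1: "moebius (mat 1) z = z" for z by (cases z) (simp_all add: mat_def)
  have "matrix_inv A ** A = mat 1" using assms matrix_inv_SL2(2) by (simp add: SL2_def)
  then show ?thesis
    using assms moebius_mult[of A "matrix_inv A"] 1 by (metis zero_neq_one)
qed

lemma moebius_inv_Fin:
  assumes "det A = 1"
  shows "moebius (matrix_inv A) (Fin z) = (if A$1$1 - A$2$1 * z = 0 then Infty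
           else Fin ((A$2$2 * z - A$1$2) / (A$1$1 - A$2$1 * z)))"
  by (simp add: matrix_inv_det_1[OF assms] algebra_simps)

text \<open>The difference formula: the numerators combine to \<open>det A * (x - y)\<close>.\<close>

lemma rdist_moebius_inv:
  assumes "det A = 1" "A$1$1 - A$2$1 * x \<noteq> 0" "A$1$1 - A$2$1 * y \<noteq> 0"
  shows "rdist (moebius (matrix_inv A) (Fin x)) (moebius (matrix_inv A) (Fin y)) =
           ereal (\<bar>x - y\<bar> / (\<bar>A$1$1 - A$2$1 * x\<bar> * \<bar>A$1$1 - A$2$1 * y\<bar>))"
proof -
  have "(A$2$2 * x - A$1$2) * (A$1$1 - A$2$1 * y) - (A$2$2 * y - A$1$2) * (A$1$1 - A$2$1 * x) = x - y"
    using assms(1) unfolding det_2 by algebra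
  then have "(A$2$2 * x - A$1$2) / (A$1$1 - A$2$1 * x) - (A$2$2 * y - A$1$2) / (A$1$1 - A$2$1 * y) =
    (x - y) / ((A$1$1 - A$2$1 * x) * (A$1$1 - A$2$1 * y))"
    using assms(2,3) by (simp add: diff_frac_eq)
  then show ?thesis
    unfolding moebius_inv_Fin[OF assms(1)] using assms(2,3)
    by (simp del: right_minus_eq add: abs_mult)
qed

section \<open>Limits of pairs realise Markoff values\<close>

text \<open>The hypotheses are in product form rather than as bounds on \<open>rdist\<close> because the product form
  is continuous in \<open>x\<close> and \<open>y\<close>. In the limit it forces \<open>\<bar>a - c u\<bar> * \<bar>a - c v\<bar> \<ge> 1\<close>, so no element of
  the group carries a limit point to \<open>\<infinity>\<close>.\<close>

lemma markoff_spectrum_limit: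
  fixes x y :: "nat \<Rightarrow> real"
  assumes "m > 0"
    and bdd: "\<And>n. \<bar>y n\<bar> \<le> 1"
    and lower: "\<And>K. K < m \<Longrightarrow> eventually (\<lambda>n. K < \<bar>x n - y n\<bar>) sequentially"
    and upper: "\<And>K A. K > m \<Longrightarrow> A \<in> \<Union>H4 \<Longrightarrow>
      eventually (\<lambda>n. \<bar>x n - y n\<bar> \<le> K * (\<bar>A$1$1 - A$2$1 * x n\<bar> * \<bar>A$1$1 - A$2$1 * y n\<bar>)) sequentially"
  shows "m \<in> markoff_spectrum"
proof -
  have upper1: "eventually (\<lambda>n. \<bar>x n - y n\<bar> \<le> K) sequentially" if "K > m" for K
    using upper[OF that Union_H4_one] by (simp add: mat_def)
  have lim: "(\<lambda>n. \<bar>x n - y n\<bar>) \<longlonglongrightarrow> m"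
  proof (rule order_tendstoI)
    fix K assume "m < K"
    then have "eventually (\<lambda>n. \<bar>x n - y n\<bar> \<le> (m + K) / 2) sequentially"
      by (intro upper1) simp
    then show "eventually (\<lambda>n. \<bar>x n - y n\<bar> < K) sequentially"
      by eventually_elim (use \<open>m < K\<close> in \<open>simp add: field_simps\<close>)
  qed (rule lower)
  then have "Bseq (\<lambda>n. \<bar>x n - y n\<bar>)" by (intro convergent_imp_Bseq convergentI)
  then obtain C where C: "\<And>n. \<bar>x n - y n\<bar> \<le> C"
    by (auto simp: Bseq_def)
  have "\<bar>x n\<bar> \<le> C + 1" for n
    using C[of n] bdd[of n] by linarith
  then have "bounded (range (\<lambda>n. (x n, y n)))"
  proof (intro boundedI[of _ "(C + 1) + 1"])
    fix z assume "z \<in> range (\<lambda>n. (x n, y n))"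
    then obtain n where "z = (x n, y n)" by auto
    then show "norm z \<le> (C + 1) + 1"
      using norm_Pair_le[of "x n" "y n"] \<open>\<bar>x n\<bar> \<le> C + 1\<close> bdd[of n] by simp
  qed
  then obtain p r where r: "strict_mono (r :: nat \<Rightarrow> nat)" "((\<lambda>n. (x n, y n)) \<circ> r) \<longlonglongrightarrow> p"
    using bounded_imp_convergent_subsequence by blast
  define u v where "u = fst p" and "v = snd p"
  have u: "(\<lambda>n. x (r n)) \<longlonglongrightarrow> u" and v: "(\<lambda>n. y (r n)) \<longlonglongrightarrow> v"
    using tendsto_fst[OF r(2)] tendsto_snd[OF r(2)] by (simp_all add: u_def v_def o_def)
  have "(\<lambda>n. \<bar>x (r n) - y (r n)\<bar>) \<longlonglongrightarrow> \<bar>u - v\<bar>"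
    by (intro tendsto_intros u v)
  moreover have "(\<lambda>n. \<bar>x (r n) - y (r n)\<bar>) \<longlonglongrightarrow> m"
    using LIMSEQ_subseq_LIMSEQ[OF lim r(1)] by (simp add: o_def)
  ultimately have uv: "\<bar>u - v\<bar> = m" by (rule LIMSEQ_unique)
  have key: "1 \<le> \<bar>A$1$1 - A$2$1 * u\<bar> * \<bar>A$1$1 - A$2$1 * v\<bar>" (is "1 \<le> ?q") if A: "A \<in> \<Union>H4" for A
  proof -
    \<comment> \<open>The limit in \<open>n\<close> comes first, for a fixed \<open>K\<close>; then \<open>K\<close> decreases to \<open>m\<close>.\<close>
    have "m \<le> K * ?q" if "K > m" for K
    proof (rule tendsto_le)
      show "(\<lambda>n. K * (\<bar>A$1$1 - A$2$1 * x (r n)\<bar> * \<bar>A$1$1 - A$2$1 * y (r n)\<bar>)) \<longlonglongrightarrow> K * ?q"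
        by (intro tendsto_intros u v)
      show "(\<lambda>n. \<bar>x (r n) - y (r n)\<bar>) \<longlonglongrightarrow> m" by fact
      show "eventually (\<lambda>n. \<bar>x (r n) - y (r n)\<bar> \<le>
          K * (\<bar>A$1$1 - A$2$1 * x (r n)\<bar> * \<bar>A$1$1 - A$2$1 * y (r n)\<bar>)) sequentially"
        using eventually_subseq[OF r(1) upper[OF that A]] by simp
    qed simp
    then have "m \<le> m * ?q"
      by (intro tendsto_lowerbound[of "\<lambda>K. K * ?q" _ "at_right m"])
        (auto intro!: tendsto_intros simp: eventually_at_right_less eventually_at_filter)
    then show ?thesis using \<open>m > 0\<close> by simp
  qed
  have mat_1_entries: "(mat 1 :: real^2^2)$1$1 = 1" "(mat 1 :: real^2^2)$2$1 = 0"
    by (simp_all add: mat_def)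
  have "markoff_value (Fin u) (Fin v) = ereal m"
    unfolding markoff_value_def
  proof (rule antisym)
    show "(SUP A\<in>\<Union>H4. rdist (moebius (matrix_inv A) (Fin u)) (moebius (matrix_inv A) (Fin v))) \<le> ereal m"
    proof (rule SUP_least)
      fix A assume A: "A \<in> \<Union>H4"
      let ?q = "\<bar>A$1$1 - A$2$1 * u\<bar> * \<bar>A$1$1 - A$2$1 * v\<bar>"
      have "1 \<le> ?q" by (rule key[OF A])
      moreover from this have "A$1$1 - A$2$1 * u \<noteq> 0" "A$1$1 - A$2$1 * v \<noteq> 0" by fastforce+
      moreover have "m / ?q \<le> m" using \<open>1 \<le> ?q\<close> \<open>m > 0\<close> by (simp add: divide_le_eq)
      ultimately show "rdist (moebius (matrix_inv A) (Fin u)) (moebius (matrix_inv A) (Fin v)) \<le> ereal m"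
        using rdist_moebius_inv[OF Union_H4_det[OF A]] uv by simp
    qed
    have one: "rdist (moebius (matrix_inv (mat 1)) (Fin u)) (moebius (matrix_inv (mat 1)) (Fin v)) = ereal m"
      using rdist_moebius_inv[of "mat 1" u v] uv mat_1_entries by (simp del: moebius.simps)
    show "ereal m \<le> (SUP A\<in>\<Union>H4. rdist (moebius (matrix_inv A) (Fin u)) (moebius (matrix_inv A) (Fin v)))"
      by (rule SUP_upper2[OF Union_H4_one]) (simp only: one order.refl)
  qed
  moreover have "Fin u \<noteq> Fin v" using uv \<open>m > 0\<close> by auto
  ultimately show ?thesis unfolding markoff_spectrum_def by blast
qed

section \<open>The Markoff spectrum is closed\<close>

text \<open>Every pair in the orbit has the same Markoff value, so the supremum is almost attained by the
  pair itself after replacing it by another one of its orbit. A further translation does not change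
  the distance and brings the second point close to 0. Since the value is finite and the points are
  distinct, neither of them is ever carried to \<open>\<infinity>\<close>.\<close>

lemma markoff_value_pair:
  assumes "\<xi> \<noteq> \<eta>" "markoff_value \<xi> \<eta> = ereal m" "K < m"
  obtains x y where "x \<noteq> y" "\<bar>y\<bar> \<le> sqrt 2 / 2" "K < \<bar>x - y\<bar>"
    "\<And>A. A \<in> \<Union>H4 \<Longrightarrow> \<bar>x - y\<bar> \<le> m * (\<bar>A$1$1 - A$2$1 * x\<bar> * \<bar>A$1$1 - A$2$1 * y\<bar>)"
proof -
  define d where "d A = rdist (moebius (matrix_inv A) \<xi>) (moebius (matrix_inv A) \<eta>)" for A
  have le: "d A \<le> ereal m" if "A \<in> \<Union>H4" for A
    unfolding assms(2)[symmetric] markoff_value_def d_def using that by (rule SUP_upper)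
  have fin: "\<exists>u v. moebius (matrix_inv A) \<xi> = Fin u \<and> moebius (matrix_inv A) \<eta> = Fin v \<and> u \<noteq> v"
    if "A \<in> \<Union>H4" for A
  proof -
    have "moebius (matrix_inv A) \<xi> \<noteq> moebius (matrix_inv A) \<eta>"
      using moebius_inj Union_H4_det Union_H4_inv assms(1) that by blast
    then show ?thesis
      using le[OF that] unfolding d_def
      by (cases "moebius (matrix_inv A) \<xi>"; cases "moebius (matrix_inv A) \<eta>") auto
  qed
  have "ereal K < (SUP A\<in>\<Union>H4. d A)"
    using assms(2,3) by (simp add: markoff_value_def d_def)
  then obtain B where B: "B \<in> \<Union>H4" "ereal K < d B"
    by (auto simp: less_SUP_iff)
  obtain u v where uv: "moebius (matrix_inv B) \<xi> = Fin u" "moebius (matrix_inv B) \<eta> = Fin v" "u \<noteq> v"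
    using fin[OF B(1)] by blast
  obtain k :: int where k: "\<bar>v - sqrt 2 * of_int k\<bar> \<le> sqrt 2 / 2"
    using translate_near_0 by blast
  define x y where "x = u - sqrt 2 * of_int k" and "y = v - sqrt 2 * of_int k"
  define C where "C = B ** translation k"
  have C: "C \<in> \<Union>H4" unfolding C_def using B translation_in_H4 Union_H4_mult by blast
  have inv_mult: "matrix_inv (A ** A') = matrix_inv A' ** matrix_inv A" if "A \<in> \<Union>H4" "A' \<in> \<Union>H4" for A A'
    using Union_H4_det[OF that(1)] Union_H4_det[OF that(2)] Union_H4_det[OF Union_H4_mult[OF that]]
    by (simp add: matrix_inv_det_1 vec_eq_iff matrix_matrix_mult_def sum_2 forall_2 algebra_simps)
  have comp: "moebius (matrix_inv (A ** A')) z = moebius (matrix_inv A') (moebius (matrix_inv A) z)"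
    if "A \<in> \<Union>H4" "A' \<in> \<Union>H4" for A A' z
    using inv_mult[OF that] moebius_mult Union_H4_det[OF Union_H4_inv[OF that(1)]] by simp
  have tr: "moebius (matrix_inv (translation k)) (Fin z) = Fin (z - sqrt 2 * of_int k)" for z
    using moebius_inv_Fin[OF Union_H4_det[OF translation_in_H4[of k]]]
    by (simp add: translation_def)
  have xy: "moebius (matrix_inv C) \<xi> = Fin x" "moebius (matrix_inv C) \<eta> = Fin y"
    unfolding C_def comp[OF B(1) translation_in_H4] uv tr x_def y_def by auto
  show ?thesis
  proof
    show "x \<noteq> y" "\<bar>y\<bar> \<le> sqrt 2 / 2" using uv k by (auto simp: x_def y_def)
    show "K < \<bar>x - y\<bar>" using B(2) uv by (simp add: d_def x_def y_def)
    fix A assume A: "A \<in> \<Union>H4"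
    have CA: "C ** A \<in> \<Union>H4" using C A Union_H4_mult by blast
    have *: "moebius (matrix_inv (C ** A)) \<xi> = moebius (matrix_inv A) (Fin x)"
      "moebius (matrix_inv (C ** A)) \<eta> = moebius (matrix_inv A) (Fin y)"
      using comp[OF C A] xy by auto
    then have nz: "A$1$1 - A$2$1 * x \<noteq> 0" "A$1$1 - A$2$1 * y \<noteq> 0"
      using fin[OF CA] moebius_inv_Fin[OF Union_H4_det[OF A]] by (metis rhat.distinct(1))+
    then show "\<bar>x - y\<bar> \<le> m * (\<bar>A$1$1 - A$2$1 * x\<bar> * \<bar>A$1$1 - A$2$1 * y\<bar>)"
      using le[OF CA] unfolding d_def * rdist_moebius_inv[OF Union_H4_det[OF A] nz]
      by (simp add: divide_le_eq)
  qed
qed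

text \<open>Apply the inequality for \<open>S\<close> to a pair that almost attains the value:
  \<open>\<bar>x - y\<bar> \<le> m \<bar>x\<bar> \<bar>y\<bar>\<close>, where \<open>\<bar>y\<bar> \<le> \<surd>2 / 2\<close> and \<open>\<bar>x\<bar> \<le> \<surd>2 / 2 + m\<close>. As \<open>\<bar>x - y\<bar>\<close> is almost \<open>m\<close>, the product
  \<open>\<bar>x\<bar> \<bar>y\<bar>\<close> is almost at least 1, which is impossible for small \<open>m\<close>. The resulting
  positive lower bound keeps the limits of Markoff values away from 0.\<close>

lemma markoff_spectrum_ge:
  assumes "m \<in> markoff_spectrum"
  shows "m \<ge> 1 / 2"
proof (rule ccontr)
  assume "\<not> m \<ge> 1 / 2"
  obtain \<xi> \<eta> where \<xi>\<eta>: "\<xi> \<noteq> \<eta>" "markoff_value \<xi> \<eta> = ereal m"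
    using assms by (auto simp: markoff_spectrum_def)
  have "m > 0"
  proof -
    obtain x y where "x \<noteq> y" and
      le: "\<And>A. A \<in> \<Union>H4 \<Longrightarrow> \<bar>x - y\<bar> \<le> m * (\<bar>A$1$1 - A$2$1 * x\<bar> * \<bar>A$1$1 - A$2$1 * y\<bar>)"
    proof -
      have "m - 1 < m" by simp
      from markoff_value_pair[OF \<xi>\<eta> this] show ?thesis using that by metis
    qed
    then show ?thesis using le[OF Union_H4_one] by (simp add: mat_def)
  qed
  obtain x y where "\<bar>y\<bar> \<le> sqrt 2 / 2" "9/10 * m < \<bar>x - y\<bar>" and
      le: "\<And>A. A \<in> \<Union>H4 \<Longrightarrow> \<bar>x - y\<bar> \<le> m * (\<bar>A$1$1 - A$2$1 * x\<bar> * \<bar>A$1$1 - A$2$1 * y\<bar>)"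
  proof -
    have "9/10 * m < m" using \<open>m > 0\<close> by simp
    from markoff_value_pair[OF \<xi>\<eta> this] show ?thesis using that by metis
  qed
  have "\<bar>x - y\<bar> \<le> m" using le[OF Union_H4_one] by (simp add: mat_def)
  then have x: "\<bar>x\<bar> \<le> sqrt 2 / 2 + m" using \<open>\<bar>y\<bar> \<le> sqrt 2 / 2\<close> by linarith
  have "9/10 * m < m * (\<bar>x\<bar> * \<bar>y\<bar>)"
    using le[OF Union_H4_generators(1)] \<open>9/10 * m < \<bar>x - y\<bar>\<close> by (simp add: matS_def)
  then have "9/10 < \<bar>x\<bar> * \<bar>y\<bar>" using \<open>m > 0\<close> by simp
  also have "\<dots> \<le> (sqrt 2 / 2 + m) * (sqrt 2 / 2)"
    using x \<open>\<bar>y\<bar> \<le> sqrt 2 / 2\<close> \<open>m > 0\<close> by (intro mult_mono) auto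
  also have "\<dots> = 1 / 2 + m * (sqrt 2 / 2)" by (simp add: algebra_simps)
  also have "\<dots> < 1 / 2 + 1 / 2 * (4 / 5)"
  proof -
    have "sqrt 2 < 8 / 5" by (rule real_less_lsqrt) (auto simp: power2_eq_square)
    then show ?thesis using \<open>\<not> m \<ge> 1 / 2\<close> \<open>m > 0\<close>
      by (intro add_strict_left_mono mult_strict_mono) auto
  qed
  finally show False by simp
qed

lemma closed_markoff_spectrum: "closed markoff_spectrum"
  unfolding closed_sequential_limits
proof (intro allI impI)
  fix ms :: "nat \<Rightarrow> real" and m
  assume "(\<forall>n. ms n \<in> markoff_spectrum) \<and> ms \<longlonglongrightarrow> m"
  then have ms: "\<And>n. ms n \<in> markoff_spectrum" and lim: "ms \<longlonglongrightarrow> m" by auto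
  have "m \<ge> 1 / 2"
    using lim by (rule LIMSEQ_le_const) (use ms markoff_spectrum_ge in auto)
  have "\<exists>x y. \<bar>y\<bar> \<le> sqrt 2 / 2 \<and> ms n - 1 / real (Suc n) < \<bar>x - y\<bar> \<and>
    (\<forall>A\<in>\<Union>H4. \<bar>x - y\<bar> \<le> ms n * (\<bar>A$1$1 - A$2$1 * x\<bar> * \<bar>A$1$1 - A$2$1 * y\<bar>))" for n
  proof -
    obtain \<xi> \<eta> where \<xi>\<eta>: "\<xi> \<noteq> \<eta>" "markoff_value \<xi> \<eta> = ereal (ms n)"
      using ms[of n] by (auto simp: markoff_spectrum_def)
    show ?thesis
      by (rule markoff_value_pair[OF \<xi>\<eta>, of "ms n - 1 / real (Suc n)"]) (simp, blast)
  qed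
  then obtain x y where y: "\<And>n. \<bar>y n\<bar> \<le> sqrt 2 / 2"
    and lower: "\<And>n. ms n - 1 / real (Suc n) < \<bar>x n - y n\<bar>"
    and upper: "\<And>n A. A \<in> \<Union>H4 \<Longrightarrow>
      \<bar>x n - y n\<bar> \<le> ms n * (\<bar>A$1$1 - A$2$1 * x n\<bar> * \<bar>A$1$1 - A$2$1 * y n\<bar>)"
    by metis
  show "m \<in> markoff_spectrum"
  proof (rule markoff_spectrum_limit)
    show "m > 0" using \<open>m \<ge> 1 / 2\<close> by simp
    show "\<bar>y n\<bar> \<le> 1" for n using y[of n] sqrt2_half_less_1 by linarith
    fix K assume "K < m"
    have "(\<lambda>n. ms n - 1 / real (Suc n)) \<longlonglongrightarrow> m - 0"
      by (intro tendsto_diff lim LIMSEQ_Suc[OF lim_1_over_n])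
    then have "eventually (\<lambda>n. K < ms n - 1 / real (Suc n)) sequentially"
      using \<open>K < m\<close> order_tendstoD(1) by fastforce
    then show "eventually (\<lambda>n. K < \<bar>x n - y n\<bar>) sequentially"
      by eventually_elim (use lower less_trans in blast)
  next
    fix K A assume "K > m" "A \<in> \<Union>H4"
    have "eventually (\<lambda>n. ms n < K) sequentially"
      using lim \<open>K > m\<close> by (rule order_tendstoD)
    then show "eventually (\<lambda>n. \<bar>x n - y n\<bar> \<le> K * (\<bar>A$1$1 - A$2$1 * x n\<bar> * \<bar>A$1$1 - A$2$1 * y n\<bar>)) sequentially"
      by eventually_elim
        (rule order_trans[OF upper[OF \<open>A \<in> \<Union>H4\<close>]], intro mult_right_mono, auto)
  qed
qed

section \<open>Lagrange values are Markoff values\<close>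

lemma Union_H4_column:
  assumes "A \<in> \<Union>H4"
  shows "A$1$1 \<in> \<int> \<union> sqrt2_Ints" "A$2$1 \<in> \<int> \<union> sqrt2_Ints"
  using Union_H4_shape[OF assms] by (auto simp: hecke_shape_def)

lemma Ints_sqrt2_Ints_abs_ge_1:
  assumes "t \<in> \<int> \<union> sqrt2_Ints" "t \<noteq> 0"
  shows "\<bar>t\<bar> \<ge> 1"
proof (cases "t \<in> \<int>")
  case True
  then show ?thesis using assms(2) by (rule Ints_nonzero_abs_ge1)
next
  case False
  then obtain k :: int where k: "t = sqrt 2 * of_int k" using assms by (auto elim: sqrt2_Ints_cases)
  then have "k \<noteq> 0" using assms(2) by auto
  then have "\<bar>real_of_int k\<bar> \<ge> 1" by (intro Ints_nonzero_abs_ge1) auto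
  then have "sqrt 2 * \<bar>real_of_int k\<bar> \<ge> 1 * 1" by (intro mult_mono) auto
  then show ?thesis using k by (simp add: abs_mult)
qed

lemma finite_Ints_sqrt2_Ints_bounded: "finite {t \<in> \<int> \<union> sqrt2_Ints. \<bar>t\<bar> \<le> B}"
proof (rule finite_subset)
  let ?I = "{-\<lceil>B\<rceil>..\<lceil>B\<rceil>}"
  show "{t \<in> \<int> \<union> sqrt2_Ints. \<bar>t\<bar> \<le> B} \<subseteq> real_of_int ` ?I \<union> (\<lambda>k. sqrt 2 * of_int k) ` ?I"
  proof
    fix t assume t: "t \<in> {t \<in> \<int> \<union> sqrt2_Ints. \<bar>t\<bar> \<le> B}"
    have I: "k \<in> ?I" if "\<bar>real_of_int k\<bar> \<le> B" for k
    proof -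
      have "real_of_int k \<le> of_int \<lceil>B\<rceil>" "- real_of_int k \<le> of_int \<lceil>B\<rceil>"
        using that le_of_int_ceiling[of B] by linarith+
      then show ?thesis by (simp flip: of_int_minus)
    qed
    show "t \<in> real_of_int ` ?I \<union> (\<lambda>k. sqrt 2 * of_int k) ` ?I"
    proof (cases "t \<in> \<int>")
      case True
      then show ?thesis using t I by (auto elim!: Ints_cases)
    next
      case False
      then obtain k :: int where k: "t = sqrt 2 * of_int k" using t by (auto elim: sqrt2_Ints_cases)
      have "1 * \<bar>real_of_int k\<bar> \<le> sqrt 2 * \<bar>real_of_int k\<bar>" by (intro mult_right_mono) auto
      then have "\<bar>real_of_int k\<bar> \<le> B" using t k by (simp add: abs_mult)
      then show ?thesis using I k by blast
    qed
  qed
qed simp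

text \<open>The finite part of the orbit of \<open>\<infinity>\<close> avoids the points \<open>\<xi>\<close> for which the Lagrange value is
  considered.\<close>

lemma Union_H4_cusp:
  assumes "A \<in> \<Union>H4"
  shows "A$1$1 / A$2$1 \<in> (\<lambda>q. sqrt 2 * q) ` \<rat>"
proof -
  obtain k l :: int where "A$1$1 = of_int k \<and> A$2$1 = sqrt 2 * of_int l \<or>
      A$1$1 = sqrt 2 * of_int k \<and> A$2$1 = of_int l"
  proof -
    from Union_H4_shape[OF assms] consider
      "A$1$1 \<in> \<int>" "A$2$1 \<in> sqrt2_Ints" | "A$1$1 \<in> sqrt2_Ints" "A$2$1 \<in> \<int>"
      unfolding hecke_shape_def by blast
    then show ?thesis
      by cases (auto elim!: Ints_cases sqrt2_Ints_cases intro: that)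
  qed
  then have "A$1$1 / A$2$1 = sqrt 2 * (of_int k / (2 * of_int l)) \<or>
      A$1$1 / A$2$1 = sqrt 2 * (of_int k / of_int l)"
  proof
    assume "A$1$1 = of_int k \<and> A$2$1 = sqrt 2 * of_int l"
    moreover have "of_int k / (sqrt 2 * of_int l) = sqrt 2 * (of_int k / (2 * of_int l))"
      by (cases "l = 0") (simp_all add: divide_simps)
    ultimately show ?thesis by simp
  qed simp
  moreover have "real_of_int k / (2 * of_int l) \<in> \<rat>" "real_of_int k / of_int l \<in> \<rat>"
    by (auto intro!: Rats_divide Rats_mult)
  ultimately show ?thesis by blast
qed

lemma finite_cusps_bounded:
  "finite {A$1$1 / A$2$1 | A. A \<in> \<Union>H4 \<and> \<bar>A$2$1\<bar> \<le> B \<and> \<bar>A$1$1 / A$2$1\<bar> \<le> C}"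
proof (rule finite_subset)
  let ?D = "{t \<in> \<int> \<union> sqrt2_Ints. \<bar>t\<bar> \<le> B}" and ?E = "{t \<in> \<int> \<union> sqrt2_Ints. \<bar>t\<bar> \<le> C * B}"
  \<comment> \<open>If \<open>A$2$1 = 0\<close>, the quotient is 0 and gives no bound on \<open>A$1$1\<close>; hence the extra element 0.\<close>
  show "finite (insert 0 ((\<lambda>(a, c). a / c) ` (?E \<times> ?D)))"
    using finite_Ints_sqrt2_Ints_bounded by blast
  show "{A$1$1 / A$2$1 | A. A \<in> \<Union>H4 \<and> \<bar>A$2$1\<bar> \<le> B \<and> \<bar>A$1$1 / A$2$1\<bar> \<le> C} \<subseteq>
      insert 0 ((\<lambda>(a, c). a / c) ` (?E \<times> ?D))"
  proof clarify
    fix A X assume A: "A \<in> X" "X \<in> H4" "\<bar>A$2$1\<bar> \<le> B" "\<bar>A$1$1 / A$2$1\<bar> \<le> C"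
      and nz: "A$1$1 / A$2$1 \<notin> (\<lambda>(a, c). a / c) ` (?E \<times> ?D)"
    show "A$1$1 / A$2$1 = 0"
    proof (rule ccontr)
      assume "A$1$1 / A$2$1 \<noteq> 0"
      then have "\<bar>A$1$1\<bar> = \<bar>A$1$1 / A$2$1\<bar> * \<bar>A$2$1\<bar>" by (simp add: abs_divide)
      also have "\<dots> \<le> C * B"
        using A(3,4) abs_ge_zero[of "A$1$1 / A$2$1"] by (intro mult_mono) (blast, linarith+)
      finally have "(A$1$1, A$2$1) \<in> ?E \<times> ?D" using Union_H4_column[of A] A by blast
      then show False using nz by force
    qed
  qed
qed

lemma approximants_eq:
  "approximants \<xi> L = {A$1$1 / A$2$1 | A. A \<in> \<Union>H4 \<and> A$2$1 \<noteq> 0 \<and>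
     \<bar>\<xi> - A$1$1 / A$2$1\<bar> < 1 / (L * (A$2$1)\<^sup>2)}"
  unfolding approximants_def by (auto split: if_splits)

text \<open>The supremum over the empty set is \<open>-\<infinity>\<close>, so a real Lagrange value is automatically positive.\<close>

lemma lagrange_value_finite:
  assumes "lagrange_value \<xi> = ereal l"
  shows "l > 0" and "\<And>L. L > l \<Longrightarrow> finite (approximants \<xi> L)"
    and "\<And>L. 0 < L \<Longrightarrow> L < l \<Longrightarrow> infinite (approximants \<xi> L)"
proof -
  let ?S = "{L. L > 0 \<and> infinite (approximants \<xi> L)}"
  have le: "L \<le> l" if "L \<in> ?S" for L
    using SUP_upper[of L ?S ereal] that assms unfolding lagrange_value_def by simp
  have "?S \<noteq> {}"
  proof
    assume "?S = {}"
    then have "lagrange_value \<xi> = bot" unfolding lagrange_value_def by (metis SUP_empty)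
    then show False using assms by (simp add: bot_ereal_def)
  qed
  then show pos: "l > 0" using le by fastforce
  show "finite (approximants \<xi> L)" if "L > l" for L
    using le[of L] that pos by fastforce
  show "infinite (approximants \<xi> L)" if "0 < L" "L < l" for L
  proof -
    have "ereal L < (SUP L\<in>?S. ereal L)" using assms that by (simp add: lagrange_value_def)
    then obtain L' where L': "L' > L" "infinite (approximants \<xi> L')" by (auto simp: less_SUP_iff)
    have "1 / (L' * c\<^sup>2) \<le> 1 / (L * c\<^sup>2)" for c
      using L' that by (cases "c = 0") (auto intro!: divide_left_mono mult_right_mono)
    then have "approximants \<xi> L' \<subseteq> approximants \<xi> L"
      unfolding approximants_def by (blast intro: less_le_trans)
    then show ?thesis using L' finite_subset by blast
  qed
qed

text \<open>With \<open>(a, c)\<close> the first column of \<open>M\<close>, the quantity \<open>\<bar>c\<bar> * \<bar>a - c * \<xi>\<bar>\<close> is the reciprocal of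
  the distance between \<open>M\<inverse>\<cdot>\<xi>\<close> and \<open>M\<inverse>\<cdot>\<infinity>\<close>.\<close>

lemma approximation_error_iff:
  fixes \<xi> a c L :: real
  assumes "c \<noteq> 0" "L > 0"
  shows "\<bar>\<xi> - a / c\<bar> < 1 / (L * c\<^sup>2) \<longleftrightarrow> L * (\<bar>c\<bar> * \<bar>a - c * \<xi>\<bar>) < 1"
proof -
  have scale: "e / k < 1 / (L * k\<^sup>2) \<longleftrightarrow> L * (k * e) < 1" if "k > 0" for e k :: real
    using that \<open>L > 0\<close> by (simp add: field_simps power2_eq_square)
  have "\<xi> - a / c = - ((a - c * \<xi>) / c)"
    using \<open>c \<noteq> 0\<close> by (simp add: diff_divide_distrib)
  then have "\<bar>\<xi> - a / c\<bar> = \<bar>a - c * \<xi>\<bar> / \<bar>c\<bar>"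
    by (simp only: abs_minus_cancel abs_divide)
  then show ?thesis
    using scale[of "\<bar>c\<bar>" "\<bar>a - c * \<xi>\<bar>"] \<open>c \<noteq> 0\<close> by simp
qed

text \<open>All approximants lie in a bounded interval, and a bounded interval contains only finitely many
  cusps of bounded denominator; so infinitely many approximants require arbitrarily large
  denominators. Right multiplication by a translation keeps the first column and moves
  \<open>A\<inverse>\<cdot>\<infinity> = - A$2$2 / A$2$1\<close> close to 0.\<close>

lemma good_approximation:
  assumes "infinite (approximants \<xi> L)" "L > 0"
  obtains A where "A \<in> \<Union>H4" "\<bar>A$2$1\<bar> > B" "A$2$1 \<noteq> 0" "\<bar>A$2$2 / A$2$1\<bar> \<le> 1"
    "\<bar>\<xi> - A$1$1 / A$2$1\<bar> < 1 / (L * (A$2$1)\<^sup>2)"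
proof -
  let ?F = "{A$1$1 / A$2$1 | A. A \<in> \<Union>H4 \<and> \<bar>A$2$1\<bar> \<le> B \<and> \<bar>A$1$1 / A$2$1\<bar> \<le> \<bar>\<xi>\<bar> + 1 / L}"
  have "\<not> approximants \<xi> L \<subseteq> ?F"
    using assms(1) finite_cusps_bounded finite_subset by blast
  then obtain A where A: "A \<in> \<Union>H4" "A$2$1 \<noteq> 0" "\<bar>\<xi> - A$1$1 / A$2$1\<bar> < 1 / (L * (A$2$1)\<^sup>2)"
    and notF: "A$1$1 / A$2$1 \<notin> ?F"
    unfolding approximants_eq by blast
  have "\<bar>A$2$1\<bar> \<ge> 1" using Union_H4_column(2)[OF A(1)] A(2) Ints_sqrt2_Ints_abs_ge_1 by blast
  then have "(A$2$1)\<^sup>2 \<ge> 1" by (metis abs_ge_zero one_le_power power2_abs)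
  then have "1 / (L * (A$2$1)\<^sup>2) \<le> 1 / L"
    using assms(2) by (intro divide_left_mono mult_pos_pos) auto
  then have "\<bar>A$1$1 / A$2$1\<bar> \<le> \<bar>\<xi>\<bar> + 1 / L" using A(3) by linarith
  then have big: "\<bar>A$2$1\<bar> > B" using notF A(1) not_less by blast
  obtain k :: int where k: "\<bar>- (A$2$2 / A$2$1) - sqrt 2 * of_int k\<bar> \<le> sqrt 2 / 2"
    using translate_near_0 by blast
  define B' where "B' = A ** translation k"
  have col: "B'$1$1 = A$1$1" "B'$2$1 = A$2$1" "B'$2$2 = A$2$1 * (sqrt 2 * of_int k) + A$2$2"
    by (simp_all add: B'_def translation_def matrix_matrix_mult_def sum_2)
  show ?thesis
  proof
    show "B' \<in> \<Union>H4" unfolding B'_def using A(1) translation_in_H4 Union_H4_mult by blast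
    show "\<bar>B'$2$1\<bar> > B" "B'$2$1 \<noteq> 0" "\<bar>\<xi> - B'$1$1 / B'$2$1\<bar> < 1 / (L * (B'$2$1)\<^sup>2)"
      using col A big by auto
    have "B'$2$2 / B'$2$1 = - (- (A$2$2 / A$2$1) - sqrt 2 * of_int k)"
      using A(2) by (simp add: col add_divide_distrib)
    then show "\<bar>B'$2$2 / B'$2$1\<bar> \<le> 1" using k sqrt2_half_less_1 by linarith
  qed
qed

text \<open>Here \<open>x n\<close> and \<open>y n\<close> are \<open>M\<^sub>n\<inverse>\<cdot>\<xi>\<close> and \<open>M\<^sub>n\<inverse>\<cdot>\<infinity>\<close>. If \<open>(p, r)\<close> is the first column of \<open>A\<close> and
  \<open>(a', c')\<close> that of \<open>M\<^sub>n ** A\<close>, then \<open>p - r * x n\<close> and \<open>p - r * y n\<close> are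
  \<open>(a' - c' * \<xi>) / (a n - c n * \<xi>)\<close> and \<open>c' / c n\<close>, so the inequality to be shown is
  \<open>1 \<le> K * \<bar>c'\<bar> * \<bar>a' - c' * \<xi>\<bar>\<close>.\<close>

lemma lagrange_subset_markoff: "lagrange_spectrum \<subseteq> markoff_spectrum"
proof
  fix l assume "l \<in> lagrange_spectrum"
  then obtain \<xi> where irr: "\<xi> \<notin> (\<lambda>q. sqrt 2 * q) ` \<rat>" and val: "lagrange_value \<xi> = ereal l"
    by (auto simp: lagrange_spectrum_def)
  have "l > 0" using lagrange_value_finite(1)[OF val] .
  define L where "L n = l * (1 - 1 / real (n + 2))" for n :: nat
  have L: "0 < L n" "L n < l" for n
    using \<open>l > 0\<close> by (auto simp: L_def)
  have "\<exists>A. A \<in> \<Union>H4 \<and> \<bar>A$2$1\<bar> > real n \<and> A$2$1 \<noteq> 0 \<and> \<bar>A$2$2 / A$2$1\<bar> \<le> 1 \<and>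
      \<bar>\<xi> - A$1$1 / A$2$1\<bar> < 1 / (L n * (A$2$1)\<^sup>2)" for n
    using good_approximation[OF lagrange_value_finite(3)[OF val L] L(1)] by metis
  then obtain M where M: "\<And>n. M n \<in> \<Union>H4" and big: "\<And>n. \<bar>M n$2$1\<bar> > real n"
    and c0: "\<And>n. M n$2$1 \<noteq> 0" and y_le: "\<And>n. \<bar>M n$2$2 / M n$2$1\<bar> \<le> 1"
    and approx: "\<And>n. \<bar>\<xi> - M n$1$1 / M n$2$1\<bar> < 1 / (L n * (M n$2$1)\<^sup>2)"
    by metis
  define a b c d where "a n = M n$1$1" and "b n = M n$1$2" and "c n = M n$2$1" and "d n = M n$2$2" for n
  note abcd = a_def b_def c_def d_def
  have det: "a n * d n - b n * c n = 1" for n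
    using Union_H4_det[OF M[of n]] by (simp add: abcd det_2)
  have cusp: "A$1$1 - A$2$1 * \<xi> \<noteq> 0" if "A \<in> \<Union>H4" "A$2$1 \<noteq> 0" for A
    using Union_H4_cusp[OF that(1)] that(2) irr by (metis eq_iff_diff_eq_0 nonzero_mult_div_cancel_left)
  have e0: "a n - c n * \<xi> \<noteq> 0" for n using cusp[OF M c0] by (simp add: abcd)
  define x y where "x n = (d n * \<xi> - b n) / (a n - c n * \<xi>)" and "y n = - (d n / c n)" for n
  have diff: "\<bar>x n - y n\<bar> = 1 / (\<bar>c n\<bar> * \<bar>a n - c n * \<xi>\<bar>)" for n
  proof -
    have "x n - y n = 1 / (c n * (a n - c n * \<xi>))"
    proof -
      have "x n - y n = ((d n * \<xi> - b n) * c n + d n * (a n - c n * \<xi>)) / (c n * (a n - c n * \<xi>))"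
        using e0[of n] c0[of n] by (simp add: x_def y_def c_def[symmetric] add_frac_eq mult.commute)
      also have "(d n * \<xi> - b n) * c n + d n * (a n - c n * \<xi>) = 1"
        using det[of n] by (simp add: algebra_simps)
      finally show ?thesis .
    qed
    then show ?thesis by (simp add: abs_mult)
  qed
  have c_inf: "filterlim (\<lambda>n. \<bar>c n\<bar>) at_top sequentially"
    using big by (intro filterlim_at_top_mono[OF filterlim_real_sequentially] always_eventually)
      (auto simp: abcd intro: less_imp_le)
  have ac_lim: "(\<lambda>n. a n / c n) \<longlonglongrightarrow> \<xi>"
  proof -
    have bound: "norm (a n / c n - \<xi>) \<le> 2 / l * (1 / real n)" if "n \<ge> 1" for n
    proof -
      have "L n \<ge> l / 2" using \<open>l > 0\<close> by (simp add: L_def field_simps)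
      moreover have "(c n)\<^sup>2 \<ge> real n"
      proof -
        have "real n * 1 \<le> \<bar>c n\<bar> * \<bar>c n\<bar>"
          using big[of n] that by (intro mult_mono) (auto simp: abcd)
        then show ?thesis by (simp add: power2_eq_square abs_mult_self_eq)
      qed
      ultimately have "1 / (L n * (c n)\<^sup>2) \<le> 1 / (l / 2 * real n)"
        using \<open>l > 0\<close> that L(1)[of n] by (intro divide_left_mono mult_mono mult_pos_pos) auto
      then show ?thesis using approx[of n] by (simp add: abcd abs_minus_commute)
    qed
    have "(\<lambda>n. 2 / l * (1 / real n)) \<longlonglongrightarrow> 2 / l * 0"
      by (intro tendsto_intros lim_1_over_n)
    then have "(\<lambda>n. 2 / l * (1 / real n)) \<longlonglongrightarrow> 0" by simp
    moreover have "eventually (\<lambda>n. norm (a n / c n - \<xi>) \<le> 2 / l * (1 / real n)) sequentially"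
      using eventually_ge_at_top[of 1] by (rule eventually_mono) (rule bound)
    ultimately have "(\<lambda>n. a n / c n - \<xi>) \<longlonglongrightarrow> 0"
      by (rule Lim_null_comparison[rotated])
    then show ?thesis by (simp add: LIM_zero_iff)
  qed
  show "l \<in> markoff_spectrum"
  proof (rule markoff_spectrum_limit)
    show "l > 0" by fact
    show "\<bar>y n\<bar> \<le> 1" for n using y_le[of n] by (simp add: y_def abcd)
  next
    fix K assume "K < l"
    have L_less: "L n < \<bar>x n - y n\<bar>" for n
    proof -
      have "L n * (\<bar>c n\<bar> * \<bar>a n - c n * \<xi>\<bar>) < 1"
        using approx[of n] approximation_error_iff[OF c0 L(1)] by (simp add: abcd)
      then show ?thesis
        unfolding diff using e0[of n] c0[of n] by (simp add: c_def[symmetric] less_divide_eq)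
    qed
    have "eventually (\<lambda>n. K < L n) sequentially"
    proof -
      have "L \<longlonglongrightarrow> l * (1 - 0)"
        unfolding L_def by (intro tendsto_intros LIMSEQ_ignore_initial_segment[OF lim_1_over_n])
      then show ?thesis using \<open>K < l\<close> by (simp add: order_tendstoD(1))
    qed
    then show "eventually (\<lambda>n. K < \<bar>x n - y n\<bar>) sequentially"
      by eventually_elim (use L_less less_trans in blast)
  next
    fix K A assume K: "K > l" and A: "A \<in> \<Union>H4"
    define p r where "p = A$1$1" and "r = A$2$1"
    \<comment> \<open>The threshold \<open>\<bar>r\<bar>\<close> is what \<open>\<bar>c n\<bar> * \<bar>q - a n / c n\<bar>\<close> could not exceed if \<open>q\<close> were the point
      \<open>M\<^sub>n ** A\<close> maps \<open>\<infinity>\<close> to.\<close>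
    have fin: "finite (approximants \<xi> K)" using lagrange_value_finite(2)[OF val K] .
    have "eventually (\<lambda>n. \<bar>r\<bar> < \<bar>c n\<bar> * \<bar>q - a n / c n\<bar>) sequentially"
      if "q \<in> approximants \<xi> K" for q
    proof -
      have "q \<noteq> \<xi>" using that irr Union_H4_cusp by (auto simp: approximants_eq)
      moreover have "(\<lambda>n. \<bar>q - a n / c n\<bar>) \<longlonglongrightarrow> \<bar>q - \<xi>\<bar>"
        by (intro tendsto_intros ac_lim)
      ultimately have "filterlim (\<lambda>n. \<bar>q - a n / c n\<bar> * \<bar>c n\<bar>) at_top sequentially"
        using c_inf by (intro filterlim_tendsto_pos_mult_at_top) auto
      then show ?thesis by (simp add: filterlim_at_top_dense mult.commute)
    qed
    then have "eventually (\<lambda>n. \<forall>q\<in>approximants \<xi> K. \<bar>r\<bar> < \<bar>c n\<bar> * \<bar>q - a n / c n\<bar>) sequentially"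
      using fin by (simp add: eventually_ball_finite)
    moreover have "eventually (\<lambda>n. \<bar>r\<bar> < \<bar>c n\<bar>) sequentially"
      using c_inf by (simp add: filterlim_at_top_dense)
    ultimately show "eventually (\<lambda>n. \<bar>x n - y n\<bar> \<le>
        K * (\<bar>A$1$1 - A$2$1 * x n\<bar> * \<bar>A$1$1 - A$2$1 * y n\<bar>)) sequentially"
    proof eventually_elim
      case (elim n)
      define a' c' where "a' = a n * p + b n * r" and "c' = c n * p + d n * r"
      define N where "N = M n ** A"
      have N: "N \<in> \<Union>H4" unfolding N_def using M A Union_H4_mult by blast
      have col: "N$1$1 = a'" "N$2$1 = c'"
        by (simp_all add: N_def a'_def c'_def abcd p_def r_def matrix_matrix_mult_def sum_2)
      have r_eq: "r = a n * c' - c n * a'"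
      proof -
        have "a n * c' - c n * a' = (a n * d n - b n * c n) * r"
          by (simp add: a'_def c'_def algebra_simps)
        then show ?thesis using det[of n] by simp
      qed
      have c': "c' \<noteq> 0"
      proof
        assume "c' = 0"
        then have "a' \<noteq> 0" using Union_H4_det[OF N] col by (auto simp: det_2)
        then have "\<bar>a'\<bar> \<ge> 1"
          using Union_H4_column(1)[OF N] col Ints_sqrt2_Ints_abs_ge_1 by metis
        then have "\<bar>c n\<bar> * 1 \<le> \<bar>c n\<bar> * \<bar>a'\<bar>" by (intro mult_left_mono) auto
        then show False using r_eq \<open>c' = 0\<close> elim(2) by (simp add: abs_mult)
      qed
      then have c'1: "\<bar>c'\<bar> \<ge> 1"
        using Union_H4_column(2)[OF N] col Ints_sqrt2_Ints_abs_ge_1 by metis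
      have "a' / c' \<notin> approximants \<xi> K"
      proof
        assume "a' / c' \<in> approximants \<xi> K"
        then have "\<bar>r\<bar> < \<bar>c n\<bar> * \<bar>a' / c' - a n / c n\<bar> * 1" using elim(1) by simp
        also have "\<dots> \<le> \<bar>c n\<bar> * \<bar>a' / c' - a n / c n\<bar> * \<bar>c'\<bar>"
          using c'1 by (intro mult_left_mono) auto
        also have "\<dots> = \<bar>c n * (a' / c' - a n / c n) * c'\<bar>" by (simp add: abs_mult)
        also have "c n * (a' / c' - a n / c n) * c' = - r"
          using c' c0[of n] by (simp add: r_eq c_def[symmetric] field_simps)
        finally show False by simp
      qed
      then have "\<not> \<bar>\<xi> - a' / c'\<bar> < 1 / (K * c'\<^sup>2)"
        unfolding approximants_eq using N c' col by blast
      then have one: "1 \<le> K * (\<bar>a' - c' * \<xi>\<bar> * \<bar>c'\<bar>)"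
        using approximation_error_iff[OF c', of K \<xi> a'] K \<open>l > 0\<close> by (simp add: mult.commute)
      have "p - r * x n = (a' - c' * \<xi>) / (a n - c n * \<xi>)"
        using e0[of n] by (simp add: x_def a'_def c'_def field_simps)
      moreover have "p - r * y n = c' / c n"
        using c0[of n] by (simp add: y_def c'_def c_def[symmetric] field_simps)
      ultimately have "K * (\<bar>p - r * x n\<bar> * \<bar>p - r * y n\<bar>) =
          K * (\<bar>a' - c' * \<xi>\<bar> * \<bar>c'\<bar>) / (\<bar>c n\<bar> * \<bar>a n - c n * \<xi>\<bar>)"
        by (simp add: abs_divide mult.commute)
      moreover have "1 / (\<bar>c n\<bar> * \<bar>a n - c n * \<xi>\<bar>) \<le> \<dots>"
        using one by (intro divide_right_mono) auto
      ultimately show ?case unfolding diff p_def[symmetric] r_def[symmetric] by simp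
    qed
  qed
qed

theorem theorem1p1:
  "closed markoff_spectrum \<and> lagrange_spectrum \<subseteq> markoff_spectrum"
  using closed_markoff_spectrum lagrange_subset_markoff by blast

end
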